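(* Let $(Y,d_Y)$ be a proper metric space and let $(H,|\cdot|)$ be a separable Hilbert space with $\dim H\ge 1$. Let $X=H\times Y$ be equipped with the product metric $$d((h_1,y_1),(h_2,y_2))=\left(|h_1-h_2|^2+d_Y(y_1,y_2)^2\right)^{1/2}.$$ Then $(\mathbb{P}_2(X),W_2)$ admits an isometric action of the orthogonal group of $H$ by exotic isometries; that is, there is an action of the orthogonal group of $H$ on $\mathbb{P}_2(X)$ by isometries of $W_2$ in which every non-identity element acts as an exotic isometry.
   Context: For a metric space $X$, $\mathbb{P}_2(X)$ is the set of Borel probability measures $\mu$ on $X$ with $\int_X d(x,x_0)^2\,d\mu(x)<\infty$ for some (hence any) $x_0\in X$, with the metric $W_2(\mu,\nu)=\inf_\pi\left(\int_{X\times X}d(x,y)^2\,d\pi(x,y)\right)^{1/2}$, where $\pi$ ranges over Borel probability measures on $X\times X$ with marginals $\mu$ and $\nu$. An isometry of a metric space is a surjective distance-preserving self-map; $\operatorname{Isom}(\cdot)$ denotes the isometry group. Each $\varphi\in\operatorname{Isom}(X)$ induces $\varphi_\#\in\operatorname{Isom}(\mathbb{P}_2(X))$ by push-forward, $\varphi_\#\mu(A)=\mu(\varphi^{-1}(A))$. An isometry of $\mathbb{P}_2(X)$ is exotic if it is not of the form $\varphi_\#$ for any $\varphi\in\operatorname{Isom}(X)$. The orthogonal group of $H$ is the group of surjective linear isometries of $H$. A metric space is proper if its closed bounded subsets are compact. *)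

theory Defs
  imports "HOL-Probability.Probability_Measure" "HOL-Algebra.Group_Action"
begin

definition isometries :: "'a set \<Rightarrow> ('a \<Rightarrow> 'a \<Rightarrow> real) \<Rightarrow> ('a \<Rightarrow> 'a) set" where
  "isometries S d = {f. f ` S = S \<and> (\<forall>x\<in>S. \<forall>y\<in>S. d (f x) (f y) = d x y)}"

definition P2 :: "'a::metric_space measure set" where
  "P2 = {\<mu>. prob_space \<mu> \<and> sets \<mu> = sets borel \<and> (\<exists>x0. integrable \<mu> (\<lambda>x. (dist x x0)\<^sup>2))}"

text \<open>The measures on the product type carry its own Borel sigma-algebra, which is the product
  sigma-algebra as soon as the factor is second countable.\<close>

definition couplings :: "'a::metric_space measure \<Rightarrow> 'a measure \<Rightarrow> ('a \<times> 'a) measure set" where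
  "couplings \<mu> \<nu> = {\<pi>. prob_space \<pi> \<and> sets \<pi> = sets borel \<and>
     distr \<pi> borel fst = \<mu> \<and> distr \<pi> borel snd = \<nu>}"

text \<open>The real-valued infimum and Bochner integral are meaningful for measures in \<open>P2\<close> over a
  separable space: couplings then exist (the product measure), costs are bounded below by 0, and
  every cost integrand is integrable (\<open>integrable_cost\<close> below).\<close>

definition W2 :: "'a::metric_space measure \<Rightarrow> 'a measure \<Rightarrow> real" where
  "W2 \<mu> \<nu> = (INF \<pi>\<in>couplings \<mu> \<nu>. sqrt (\<integral>p. (dist (fst p) (snd p))\<^sup>2 \<partial>\<pi>))"

definition exotic :: "('a::metric_space measure \<Rightarrow> 'a measure) \<Rightarrow> bool" where
  "exotic F \<longleftrightarrow> F \<in> isometries P2 W2 \<and>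
     \<not> (\<exists>\<phi>\<in>isometries UNIV dist. \<forall>\<mu>\<in>P2. F \<mu> = distr \<mu> borel \<phi>)"

definition orthogonal_group :: "('h::real_inner \<Rightarrow> 'h) monoid" where
  "orthogonal_group =
     \<lparr>carrier = {f. orthogonal_transformation f \<and> surj f}, mult = (\<circ>), one = id\<rparr>"

lemma dist_sq_le: "(dist x y)\<^sup>2 \<le> 2 * (dist x z)\<^sup>2 + 2 * (dist y z)\<^sup>2"
proof -
  have "(dist x y)\<^sup>2 \<le> (dist x z + dist y z)\<^sup>2"
    by (intro power_mono dist_triangle2) auto
  moreover have "0 \<le> (dist x z - dist y z)\<^sup>2" by simp
  ultimately show ?thesis by (simp add: power2_sum power2_diff)
qed

lemma P2_any_basepoint:
  assumes "\<mu> \<in> P2"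
  shows "integrable \<mu> (\<lambda>x. (dist x a)\<^sup>2)"
proof -
  from assms obtain b where p: "prob_space \<mu>" and s [measurable_cong]: "sets \<mu> = sets borel"
    and i: "integrable \<mu> (\<lambda>x. (dist x b)\<^sup>2)" by (auto simp: P2_def)
  interpret prob_space \<mu> by fact
  have "(\<lambda>x. (dist x a)\<^sup>2) \<in> borel_measurable borel"
    by (intro borel_measurable_continuous_onI continuous_intros)
  then have m: "(\<lambda>x. (dist x a)\<^sup>2) \<in> borel_measurable \<mu>"
    by measurable
  show ?thesis
  proof (rule Bochner_Integration.integrable_bound[OF _ m])
    show "integrable \<mu> (\<lambda>x. 2 * (dist x b)\<^sup>2 + 2 * (dist a b)\<^sup>2)" using i by simp
    show "AE x in \<mu>. norm ((dist x a)\<^sup>2) \<le> norm (2 * (dist x b)\<^sup>2 + 2 * (dist a b)\<^sup>2)"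
      by (simp add: dist_sq_le)
  qed
qed

lemma integrable_cost:
  assumes "\<mu> \<in> P2" "\<nu> \<in> P2" "\<pi> \<in> couplings \<mu> \<nu>"
  shows "integrable \<pi> (\<lambda>p. (dist (fst p) (snd p))\<^sup>2)"
proof -
  fix a
  have s [measurable_cong]: "sets \<pi> = sets borel"
    and d1: "distr \<pi> borel fst = \<mu>" and d2: "distr \<pi> borel snd = \<nu>"
    using assms(3) by (auto simp: couplings_def)
  have "fst \<in> borel_measurable (borel :: ('a \<times> 'a) measure)"
    "snd \<in> borel_measurable (borel :: ('a \<times> 'a) measure)"
    "(\<lambda>p::'a \<times> 'a. (dist (fst p) (snd p))\<^sup>2) \<in> borel_measurable borel"
    "(\<lambda>x::'a. (dist x a)\<^sup>2) \<in> borel_measurable borel"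
    by (intro borel_measurable_continuous_onI continuous_intros)+
  then have m: "fst \<in> borel_measurable \<pi>" "snd \<in> borel_measurable \<pi>"
    "(\<lambda>p. (dist (fst p) (snd p))\<^sup>2) \<in> borel_measurable \<pi>"
    and ma: "(\<lambda>x::'a. (dist x a)\<^sup>2) \<in> borel_measurable borel"
    by (auto simp: measurable_cong_sets[OF s refl])
  have "integrable \<pi> (\<lambda>p. (dist (fst p) a)\<^sup>2)"
    using P2_any_basepoint[OF assms(1), of a] integrable_distr_eq[OF m(1) ma] d1 by simp
  moreover have "integrable \<pi> (\<lambda>p. (dist (snd p) a)\<^sup>2)"
    using P2_any_basepoint[OF assms(2), of a] integrable_distr_eq[OF m(2) ma] d2 by simp
  ultimately have
    "integrable \<pi> (\<lambda>p. 2 * (dist (fst p) a)\<^sup>2 + 2 * (dist (snd p) a)\<^sup>2)" by simp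
  then show ?thesis
    by (rule Bochner_Integration.integrable_bound[OF _ m(3)]) (simp add: dist_sq_le)
qed

end

theory Submission
  imports Defs "HOL-Probability.Probability_Mass_Function"
begin

text \<open>An orthogonal transformation \<open>A\<close> acts on \<open>\<mu>\<close> by rotating the \<open>H\<close>-coordinate about its own
  mean \<open>b\<close>, i.e. by the push-forward along \<open>(h, y) \<mapsto> (b + A (h - b), y)\<close>; the mean is
  preserved. Transporting a coupling of \<open>\<mu>\<close> and \<open>\<nu>\<close> along both maps changes its cost only by the
  integral of an inner product of the centred difference with a fixed vector, which vanishes. Dirac
  measures are fixed, so an isometry of \<open>X\<close> inducing the action of \<open>A\<close> would be the identity,
  although \<open>A\<close> moves the measure with masses \<open>1/3\<close> at \<open>(2h, y)\<close> and \<open>2/3\<close> at \<open>(-h, y)\<close> whenever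
  \<open>A h \<noteq> h\<close>.\<close>

section \<open>Riesz representation of bounded functionals\<close>

text \<open>Completing the square shows that \<open>b \<bullet> b - 2 * L b\<close> is the squared
  distance from \<open>b\<close> to the representing vector, minus a constant, so that vector is
  sought as a minimizer. Completeness provides it as the limit of a minimizing sequence, and the
  first variation there must vanish.\<close>

lemma riesz_representation:
  fixes L :: "'h::{real_inner, complete_space} \<Rightarrow> real"
  assumes "bounded_linear L"
  shows "\<exists>b. \<forall>v. L v = b \<bullet> v"
proof -
  interpret bounded_linear L by fact
  define G where "G b = b \<bullet> b - 2 * L b" for b
  obtain K where K: "\<And>x. norm (L x) \<le> norm x * K" using bounded by blast
  \<comment> \<open>The bound on \<open>L\<close> gives G b >= |b|^2 - 2 K |b| = (|b| - K)^2 -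
    K^2.\<close>
  have lower: "- K\<^sup>2 \<le> G b" for b
  proof -
    have "0 \<le> (norm b - K)\<^sup>2" by simp
    then show ?thesis using K[of b]
      by (auto simp: G_def power2_norm_eq_inner[symmetric] power2_diff)
  qed
  define m where "m = (INF b. G b)"
  have bdd: "bdd_below (range G)" using lower by (auto intro!: bdd_belowI)
  have m_le: "m \<le> G b" for b unfolding m_def by (rule cINF_lower[OF bdd]) simp
  have "\<exists>b. G b < m + inverse (real (Suc n))" for n
  proof -
    have "Inf (range G) < m + inverse (real (Suc n))" by (simp add: m_def)
    then show ?thesis using cInf_lessD[of "range G"] by blast
  qed
  then obtain x where x: "\<And>n. G (x n) < m + inverse (real (Suc n))" by metis
  \<comment> \<open>Parallelogram law: the linear part of \<open>G\<close> cancels against the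
    midpoint \<open>c\<close>, so two near-minimizers are close to each other.\<close>
  have par: "(dist a b)\<^sup>2 \<le> 2 * G a + 2 * G b - 4 * m" for a b
  proof -
    define c where "c = (1/2) *\<^sub>R (a + b)"
    have "(dist a b)\<^sup>2 = 2 * G a + 2 * G b - 4 * G c"
      by (simp add: c_def G_def dist_norm power2_norm_eq_inner add scaleR algebra_simps inner_commute)
    then show ?thesis using m_le[of c] by linarith
  qed
  have "Cauchy x"
  proof (rule metric_CauchyI)
    fix e :: real assume "0 < e"
    \<comment> \<open>If both values of \<open>G\<close> are below m + q, then \<open>par\<close>
      bounds the squared distance by 4 q = e^2.\<close>
    define q where "q = e\<^sup>2 / 4"
    have "0 < q" using \<open>0 < e\<close> by (simp add: q_def)
    then obtain N where N: "inverse (real (Suc N)) < q" using reals_Archimedean by blast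
    have small: "G (x n) < m + q" if "n \<ge> N" for n
    proof -
      have "inverse (real (Suc n)) \<le> inverse (real (Suc N))"
        using that by (intro le_imp_inverse_le) auto
      with x[of n] N show ?thesis by linarith
    qed
    have "dist (x k) (x n) < e" if "k \<ge> N" "n \<ge> N" for k n
    proof -
      have "(dist (x k) (x n))\<^sup>2 < 4 * q"
        by (rule le_less_trans[OF par]) (use small[OF that(1)] small[OF that(2)] in linarith)
      then have "(dist (x k) (x n))\<^sup>2 < e\<^sup>2" by (simp add: q_def)
      then show ?thesis using \<open>0 < e\<close> by (simp add: power2_less_imp_less)
    qed
    then show "\<exists>N. \<forall>k\<ge>N. \<forall>n\<ge>N. dist (x k) (x n) < e" by blast
  qed
  then obtain b where b: "x \<longlonglongrightarrow> b"
    using Cauchy_convergent convergent_def by blast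
  have "(\<lambda>n. G (x n)) \<longlonglongrightarrow> G b"
    unfolding G_def by (intro tendsto_intros b tendsto)
  moreover have "(\<lambda>n. m + inverse (real (Suc n))) \<longlonglongrightarrow> m + 0"
    by (intro tendsto_intros LIMSEQ_inverse_real_of_nat)
  ultimately have "G b \<le> m + 0"
    by (rule LIMSEQ_le) (use x less_imp_le in blast)
  then have Gb: "G b \<le> G a" for a using m_le[of a] by linarith
  have "L v = b \<bullet> v" for v
  proof -
    define c where "c = b \<bullet> v - L v"
    define s where "s = v \<bullet> v"
    have s: "0 \<le> s" by (simp add: s_def)
    \<comment> \<open>A step against the sign of \<open>c\<close>. Dividing by s + 1 rather than s
      covers v = 0; multiplied by (s + 1)^2, the increment of \<open>G\<close> becomes -c^2 (s + 2),
      which can be nonnegative only for c = 0.\<close>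
    define t where "t = - c / (s + 1)"
    have "G (b + t *\<^sub>R v) = G b + 2 * t * c + t\<^sup>2 * s"
      by (simp add: G_def c_def s_def add scaleR algebra_simps inner_commute power2_eq_square)
    then have "0 \<le> 2 * t * c + t\<^sup>2 * s" using Gb[of "b + t *\<^sub>R v"] by linarith
    then have "0 \<le> (2 * t * c + t\<^sup>2 * s) * (s + 1)\<^sup>2" by simp
    also have "\<dots> = 2 * (t * (s + 1)) * c * (s + 1) + (t * (s + 1))\<^sup>2 * s"
      by (simp add: algebra_simps power2_eq_square)
    also have "t * (s + 1) = - c" using s by (simp add: t_def)
    finally have "c\<^sup>2 * (s + 2) \<le> 0" by (simp add: algebra_simps power2_eq_square)
    then have "c = 0" using s by (simp add: mult_le_0_iff)
    then show ?thesis by (simp add: c_def)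
  qed
  then show ?thesis by blast
qed

section \<open>First moments and barycenters\<close>

lemma P2D:
  assumes "\<mu> \<in> P2"
  shows "prob_space \<mu>" "sets \<mu> = sets borel" "space \<mu> = UNIV"
  using assms sets_eq_imp_space_eq[of \<mu> borel] by (auto simp: P2_def)

lemma continuous_borel_measurable:
  assumes "sets M = sets (borel :: 'a::topological_space measure)" "continuous_on UNIV f"
  shows "f \<in> measurable M borel"
  using borel_measurable_continuous_onI[OF assms(2)] measurable_cong_sets[OF assms(1) refl] by blast

text \<open>Second moments control first moments through 2 r <= 1 + r^2, the constant being
  integrable for a probability measure. The base point has \<open>H\<close>-coordinate 0, so its
  distance to \<open>x\<close> dominates the norm of \<open>fst x\<close>.\<close>

lemma P2_integrable_norm_fst:
  fixes \<mu> :: "('h::real_inner \<times> 'y::metric_space) measure"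
  assumes "\<mu> \<in> P2"
  shows "integrable \<mu> (\<lambda>x. norm (fst x))"
proof -
  interpret prob_space \<mu> using P2D(1)[OF assms] .
  fix y :: 'y
  have "integrable \<mu> (\<lambda>x. 1 + (dist x (0, y))\<^sup>2)"
    using P2_any_basepoint[OF assms] by simp
  then show ?thesis
  proof (rule Bochner_Integration.integrable_bound)
    show "(\<lambda>x. norm (fst x)) \<in> borel_measurable \<mu>"
      by (rule continuous_borel_measurable[OF P2D(2)[OF assms]]) (intro continuous_intros)
    have "norm (fst x) \<le> 1 + (dist x (0, y))\<^sup>2" for x :: "'h \<times> 'y"
    proof -
      have "0 \<le> (norm (fst x) - 1)\<^sup>2" by simp
      then have "2 * norm (fst x) \<le> 1 + (norm (fst x))\<^sup>2" by (simp add: power2_diff)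
      moreover have "(norm (fst x))\<^sup>2 \<le> (dist x (0, y))\<^sup>2" by (simp add: dist_prod_def)
      ultimately show ?thesis using norm_ge_zero[of "fst x"] by linarith
    qed
    then show "AE x in \<mu>. norm (norm (fst x)) \<le> norm (1 + (dist x (0, y))\<^sup>2)" by simp
  qed
qed

lemma P2_integrable_inner_fst:
  fixes \<mu> :: "('h::real_inner \<times> 'y::metric_space) measure"
  assumes "\<mu> \<in> P2"
  shows "integrable \<mu> (\<lambda>x. fst x \<bullet> v)"
proof (rule Bochner_Integration.integrable_bound)
  show "integrable \<mu> (\<lambda>x. norm (fst x) * norm v)" using P2_integrable_norm_fst[OF assms] by simp
  show "(\<lambda>x. fst x \<bullet> v) \<in> borel_measurable \<mu>"
    by (rule continuous_borel_measurable[OF P2D(2)[OF assms]]) (intro continuous_intros)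
  show "AE x in \<mu>. norm (fst x \<bullet> v) \<le> norm (norm (fst x) * norm v)"
    by (simp add: Cauchy_Schwarz_ineq2)
qed

text \<open>A weak (Pettis) integral: the sort of \<open>'h\<close> does not entail \<open>banach\<close>, so the Bochner
  integral is not available for functions into \<open>'h\<close>.\<close>

definition barycenter :: "('h::real_inner \<times> 'y::metric_space) measure \<Rightarrow> 'h" where
  "barycenter \<mu> = (THE b. \<forall>v. (\<integral>x. fst x \<bullet> v \<partial>\<mu>) = b \<bullet> v)"

lemma barycenter_eqI:
  assumes "\<And>v. (\<integral>x. fst x \<bullet> v \<partial>\<mu>) = b \<bullet> v"
  shows "barycenter \<mu> = b"
  unfolding barycenter_def
proof (rule the_equality)
  fix c assume c: "\<forall>v. (\<integral>x. fst x \<bullet> v \<partial>\<mu>) = c \<bullet> v"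
  \<comment> \<open>Both candidates are tested against v = c - b.\<close>
  then have "(c - b) \<bullet> (c - b) = 0" using assms by (simp add: inner_diff_left)
  then show "c = b" by simp
qed (use assms in simp)

text \<open>The functional on the left is bounded by the first moment, so Riesz yields a vector
  representing it; with uniqueness from \<open>barycenter_eqI\<close>, the definite description
  denotes that vector.\<close>

lemma inner_barycenter:
  fixes \<mu> :: "('h::{real_inner, complete_space} \<times> 'y::metric_space) measure"
  assumes "\<mu> \<in> P2"
  shows "(\<integral>x. fst x \<bullet> v \<partial>\<mu>) = barycenter \<mu> \<bullet> v"
proof -
  note I = P2_integrable_inner_fst[OF assms]
  have "bounded_linear (\<lambda>v. \<integral>x. fst x \<bullet> v \<partial>\<mu>)"
  proof (rule bounded_linear_intro)
    fix v w :: 'h and r :: real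
    show "(\<integral>x. fst x \<bullet> (v + w) \<partial>\<mu>) = (\<integral>x. fst x \<bullet> v \<partial>\<mu>) + (\<integral>x. fst x \<bullet> w \<partial>\<mu>)"
      by (simp add: inner_add_right I)
    show "(\<integral>x. fst x \<bullet> (r *\<^sub>R v) \<partial>\<mu>) = r *\<^sub>R (\<integral>x. fst x \<bullet> v \<partial>\<mu>)"
      by simp
    have "norm (\<integral>x. fst x \<bullet> v \<partial>\<mu>) \<le> (\<integral>x. norm (fst x \<bullet> v) \<partial>\<mu>)"
      by (rule integral_norm_bound)
    also have "\<dots> \<le> (\<integral>x. norm (fst x) * norm v \<partial>\<mu>)"
      by (rule integral_mono)
        (use I P2_integrable_norm_fst[OF assms] in \<open>simp_all add: Cauchy_Schwarz_ineq2\<close>)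
    also have "\<dots> = norm v * (\<integral>x. norm (fst x) \<partial>\<mu>)" by simp
    finally show "norm (\<integral>x. fst x \<bullet> v \<partial>\<mu>) \<le> norm v * (\<integral>x. norm (fst x) \<partial>\<mu>)" .
  qed
  then obtain b where "\<forall>v. (\<integral>x. fst x \<bullet> v \<partial>\<mu>) = b \<bullet> v"
    using riesz_representation by blast
  then show ?thesis using barycenter_eqI[of \<mu> b] by simp
qed

section \<open>Rotating a measure about its barycenter\<close>

definition rotate_about :: "('h::real_inner \<Rightarrow> 'h) \<Rightarrow> 'h \<Rightarrow> 'h \<times> 'y \<Rightarrow> 'h \<times> 'y" where
  "rotate_about A b p = (b + A (fst p - b), snd p)"

definition rotate_measure ::
  "('h::real_inner \<Rightarrow> 'h) \<Rightarrow> ('h \<times> 'y::metric_space) measure \<Rightarrow> ('h \<times> 'y) measure" where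
  "rotate_measure A \<mu> = distr \<mu> borel (rotate_about A (barycenter \<mu>))"

lemma orthogonal_transformation_continuous_on:
  fixes A :: "'h::real_inner \<Rightarrow> 'h"
  assumes "orthogonal_transformation A"
  shows "continuous_on S A"
proof -
  have l: "linear A" and i: "\<And>v w. A v \<bullet> A w = v \<bullet> w"
    using assms by (auto simp: orthogonal_transformation_def)
  have "bounded_linear A"
    by (rule bounded_linear_intro[where K = 1])
      (auto simp: linear_add[OF l] linear_scale[OF l] norm_eq_sqrt_inner i)
  then show ?thesis by (rule linear_continuous_on)
qed

lemma continuous_on_rotate_about [continuous_intros]:
  fixes f :: "'a::topological_space \<Rightarrow> 'h::real_inner \<times> 'y::metric_space"
  assumes "orthogonal_transformation A" "continuous_on S f"
  shows "continuous_on S (\<lambda>x. rotate_about A b (f x))"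
proof -
  have "continuous_on S (\<lambda>x. A (fst (f x) - b))"
    by (rule continuous_on_compose2[OF orthogonal_transformation_continuous_on[OF assms(1), of UNIV]])
      (intro continuous_intros assms(2) subset_UNIV)+
  then show ?thesis
    unfolding rotate_about_def by (intro continuous_intros assms(2))
qed

lemma rotate_about_measurable:
  fixes A :: "'h::real_inner \<Rightarrow> 'h"
  assumes "orthogonal_transformation A"
    and "sets M = sets (borel :: ('h \<times> 'y::metric_space) measure)"
  shows "rotate_about A b \<in> measurable M (borel :: ('h \<times> 'y) measure)"
  using continuous_borel_measurable[OF assms(2) continuous_on_rotate_about[OF assms(1)
      continuous_on_id]] by simp

text \<open>The rotation fixes every point whose first coordinate is the centre, so it preserves
  distances to such a point. \<open>P2_any_basepoint\<close> allows the second moment to be measured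
  from there.\<close>

lemma rotate_measure_P2:
  fixes A :: "'h::real_inner \<Rightarrow> 'h" and \<mu> :: "('h \<times> 'y::metric_space) measure"
  assumes A: "orthogonal_transformation A" and "\<mu> \<in> P2"
  shows "rotate_measure A \<mu> \<in> P2"
proof -
  note \<mu> = P2D[OF \<open>\<mu> \<in> P2\<close>]
  let ?b = "barycenter \<mu>"
  fix y :: 'y
  note m = rotate_about_measurable[OF A \<mu>(2), of ?b]
  have eq: "dist (rotate_about A ?b x) (?b, y) = dist x (?b, y)" for x
    using A by (simp add: dist_prod_def rotate_about_def dist_norm norm_eq_sqrt_inner
        orthogonal_transformation_def)
  have "(\<lambda>x::'h \<times> 'y. (dist x (?b, y))\<^sup>2) \<in> borel_measurable borel"
    by (intro borel_measurable_continuous_onI continuous_intros)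
  then have "integrable (rotate_measure A \<mu>) (\<lambda>x. (dist x (?b, y))\<^sup>2)"
    unfolding rotate_measure_def
    using P2_any_basepoint[OF assms(2)] by (subst integrable_distr_eq[OF m]) (simp_all add: eq)
  moreover have "prob_space (rotate_measure A \<mu>)"
    unfolding rotate_measure_def by (rule prob_space.prob_space_distr[OF \<mu>(1) m])
  ultimately show ?thesis by (auto simp: P2_def rotate_measure_def)
qed

lemma orthogonal_groupD:
  assumes "A \<in> carrier orthogonal_group"
  shows "orthogonal_transformation A" "surj A" "linear A" "A v \<bullet> A w = v \<bullet> w"
  using assms by (auto simp: orthogonal_group_def orthogonal_transformation_def)

text \<open>This cancellation underlies both the invariance of the barycenter and that of the
  transport cost.\<close>

lemma integral_inner_fst_diff_barycenter:
  fixes \<mu> :: "('h::{real_inner, complete_space} \<times> 'y::metric_space) measure"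
  assumes "\<mu> \<in> P2"
  shows "(\<integral>x. (fst x - barycenter \<mu>) \<bullet> v \<partial>\<mu>) = 0"
proof -
  interpret prob_space \<mu> using P2D(1)[OF assms] .
  show ?thesis
    by (simp add: inner_diff_left P2_integrable_inner_fst[OF assms] inner_barycenter[OF assms] prob_space)
qed

lemma barycenter_rotate_measure:
  fixes \<mu> :: "('h::{real_inner, complete_space} \<times> 'y::metric_space) measure"
  assumes A: "A \<in> carrier orthogonal_group" and "\<mu> \<in> P2"
  shows "barycenter (rotate_measure A \<mu>) = barycenter \<mu>"
proof (rule barycenter_eqI)
  fix v
  note \<mu> = P2D[OF \<open>\<mu> \<in> P2\<close>]
  interpret prob_space \<mu> using \<mu>(1) .
  let ?b = "barycenter \<mu>"
  \<comment> \<open>Surjectivity replaces the adjoint: pairing \<open>A (fst x - b)\<close> with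
    \<open>A w\<close> is pairing \<open>fst x - b\<close> with \<open>w\<close>.\<close>
  obtain w where w: "v = A w" using orthogonal_groupD(2)[OF A] by (metis surj_def)
  note m = rotate_about_measurable[OF orthogonal_groupD(1)[OF A] \<mu>(2), of ?b]
  have "(\<lambda>x::'h \<times> 'y. fst x \<bullet> v) \<in> borel_measurable borel"
    by (intro borel_measurable_continuous_onI continuous_intros)
  then have "(\<integral>x. fst x \<bullet> v \<partial>rotate_measure A \<mu>) = (\<integral>x. fst (rotate_about A ?b x) \<bullet> v \<partial>\<mu>)"
    unfolding rotate_measure_def by (rule integral_distr[OF m])
  also have "\<dots> = (\<integral>x. ?b \<bullet> v + (fst x - ?b) \<bullet> w \<partial>\<mu>)"
    by (simp add: rotate_about_def inner_add_left w orthogonal_groupD(4)[OF A])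
  also have "\<dots> = (\<integral>x. ?b \<bullet> v \<partial>\<mu>) + (\<integral>x. (fst x - ?b) \<bullet> w \<partial>\<mu>)"
    using P2_integrable_inner_fst[OF assms(2)]
    by (intro Bochner_Integration.integral_add) (auto simp: inner_diff_left)
  also have "\<dots> = ?b \<bullet> v"
    by (simp add: integral_inner_fst_diff_barycenter[OF assms(2)] prob_space)
  finally show "(\<integral>x. fst x \<bullet> v \<partial>rotate_measure A \<mu>) = ?b \<bullet> v" .
qed

lemma rotate_measure_id:
  assumes "\<mu> \<in> P2"
  shows "rotate_measure id \<mu> = \<mu>"
proof -
  have eq: "rotate_about id (barycenter \<mu>) = (\<lambda>x. x)" by (auto simp: rotate_about_def)
  show ?thesis unfolding rotate_measure_def eq by (rule distr_id2) (simp add: P2D(2)[OF assms])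
qed

text \<open>Since \<open>B\<close> leaves the barycenter in place, both rotations have the same
  centre, and the point maps compose.\<close>

lemma rotate_measure_comp:
  fixes \<mu> :: "('h::{real_inner, complete_space} \<times> 'y::metric_space) measure"
  assumes A: "A \<in> carrier orthogonal_group" and B: "B \<in> carrier orthogonal_group"
    and \<mu>: "\<mu> \<in> P2"
  shows "rotate_measure (A \<circ> B) \<mu> = rotate_measure A (rotate_measure B \<mu>)"
proof -
  have "rotate_measure A (rotate_measure B \<mu>) =
      distr (distr \<mu> borel (rotate_about B (barycenter \<mu>))) borel (rotate_about A (barycenter \<mu>))"
    unfolding rotate_measure_def[of A] barycenter_rotate_measure[OF B \<mu>]
    by (simp add: rotate_measure_def)
  also have "\<dots> = distr \<mu> borel (rotate_about A (barycenter \<mu>) \<circ> rotate_about B (barycenter \<mu>))"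
    by (rule distr_distr)
      (intro rotate_about_measurable orthogonal_groupD(1) A B P2D(2)[OF \<mu>] refl)+
  also have "\<dots> = rotate_measure (A \<circ> B) \<mu>"
    by (simp add: rotate_measure_def comp_def rotate_about_def[abs_def])
  finally show ?thesis by simp
qed

section \<open>The orthogonal group\<close>

lemma group_orthogonal_group: "group (orthogonal_group :: ('h::real_inner \<Rightarrow> 'h) monoid)"
proof (rule groupI)
  fix A B C :: "'h \<Rightarrow> 'h"
  assume A: "A \<in> carrier orthogonal_group"
  show "\<one>\<^bsub>orthogonal_group\<^esub> \<otimes>\<^bsub>orthogonal_group\<^esub> A = A" by (simp add: orthogonal_group_def)
  \<comment> \<open>The carrier asks only for surjectivity; injectivity follows because a vector
    sent to 0 has norm 0.\<close>
  have "inj A"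
  proof (rule injI)
    fix x y assume "A x = A y"
    then have "A (x - y) = 0" by (simp add: linear_diff[OF orthogonal_groupD(3)[OF A]])
    then show "x = y" using orthogonal_groupD(4)[OF A, of "x - y" "x - y"] by simp
  qed
  then have "bij A" using orthogonal_groupD(2)[OF A] by (simp add: bij_def)
  then have l: "A (inv_into UNIV A x) = x" and r: "inv_into UNIV A (A x) = x" for x
    by (simp_all add: bij_is_surj surj_f_inv_f bij_is_inj)
  have "linear (inv_into UNIV A)"
  proof (rule linearI)
    show "inv_into UNIV A (x + y) = inv_into UNIV A x + inv_into UNIV A y" for x y
      by (metis l r linear_add[OF orthogonal_groupD(3)[OF A]])
    show "inv_into UNIV A (c *\<^sub>R x) = c *\<^sub>R inv_into UNIV A x" for c x
      by (metis l r linear_scale[OF orthogonal_groupD(3)[OF A]])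
  qed
  moreover have "inv_into UNIV A v \<bullet> inv_into UNIV A w = v \<bullet> w" for v w
    using orthogonal_groupD(4)[OF A, of "inv_into UNIV A v" "inv_into UNIV A w"] by (simp add: l)
  moreover have "surj (inv_into UNIV A)" using \<open>bij A\<close> by (simp add: bij_imp_bij_inv bij_is_surj)
  ultimately have "inv_into UNIV A \<in> carrier orthogonal_group"
    by (simp add: orthogonal_group_def orthogonal_transformation_def)
  moreover have "inv_into UNIV A \<otimes>\<^bsub>orthogonal_group\<^esub> A = \<one>\<^bsub>orthogonal_group\<^esub>"
    by (auto simp: orthogonal_group_def r)
  ultimately show "\<exists>B\<in>carrier orthogonal_group.
      B \<otimes>\<^bsub>orthogonal_group\<^esub> A = \<one>\<^bsub>orthogonal_group\<^esub>" by blast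
next
  fix A B :: "'h \<Rightarrow> 'h"
  assume A: "A \<in> carrier orthogonal_group" and B: "B \<in> carrier orthogonal_group"
  have "linear (A \<circ> B)" "surj (A \<circ> B)"
    using linear_compose[of B A] comp_surj[of B A] orthogonal_groupD(2,3)[OF A]
      orthogonal_groupD(2,3)[OF B] by blast+
  then have "A \<circ> B \<in> carrier orthogonal_group"
    using orthogonal_groupD(4)[OF A] orthogonal_groupD(4)[OF B]
    by (simp add: orthogonal_group_def orthogonal_transformation_def)
  then show "A \<otimes>\<^bsub>orthogonal_group\<^esub> B \<in> carrier orthogonal_group"
    by (simp add: orthogonal_group_def)
qed (simp_all add: orthogonal_group_def orthogonal_transformation_def linear_id comp_assoc)

section \<open>Invariance of \<open>W2\<close> and the group action\<close>

text \<open>Let u be the difference of the centred \<open>H\<close>-coordinates and a, b the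
  barycenters. The displacement u + (a - b) becomes A u + (a - b), so the squared lengths differ
  only in the cross term, which is linear in u and integrates to 0.\<close>

lemma rotate_measure_coupling:
  fixes \<mu> \<nu> :: "('h::{real_inner, complete_space} \<times> 'y::metric_space) measure"
  assumes A: "A \<in> carrier orthogonal_group" and \<mu>: "\<mu> \<in> P2" and \<nu>: "\<nu> \<in> P2"
    and \<pi>: "\<pi> \<in> couplings \<mu> \<nu>"
  shows "\<exists>\<pi>'\<in>couplings (rotate_measure A \<mu>) (rotate_measure A \<nu>).
    (\<integral>p. (dist (fst p) (snd p))\<^sup>2 \<partial>\<pi>') = (\<integral>p. (dist (fst p) (snd p))\<^sup>2 \<partial>\<pi>)"
proof -
  define a where "a = barycenter \<mu>"
  define b where "b = barycenter \<nu>"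
  define T where "T = (\<lambda>p. (rotate_about A a (fst p), rotate_about A b (snd p)) ::
    ('h \<times> 'y) \<times> ('h \<times> 'y))"
  have p: "prob_space \<pi>" and s: "sets \<pi> = sets borel"
    and d1: "distr \<pi> borel fst = \<mu>" and d2: "distr \<pi> borel snd = \<nu>"
    using \<pi> by (auto simp: couplings_def)
  interpret prob_space \<pi> by (rule p)
  note A' = orthogonal_groupD[OF A]
  \<comment> \<open>Continuity gives measurability into the Borel sets of the product type;
    componentwise measurability would reach only the product sigma-algebra, which may be smaller
    without second countability.\<close>
  have "continuous_on UNIV T"
    unfolding T_def by (intro continuous_intros A'(1))
  then have T: "T \<in> measurable \<pi> borel" by (rule continuous_borel_measurable[OF s])
  have fst_m: "fst \<in> measurable M borel" and snd_m: "snd \<in> measurable M borel"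
    if "sets M = sets borel" for M :: "(('h \<times> 'y) \<times> ('h \<times> 'y)) measure"
    by (intro continuous_borel_measurable[OF that] continuous_intros)+
  have rot: "rotate_about A c \<in> measurable (borel :: ('h \<times> 'y) measure) borel" for c
    by (intro rotate_about_measurable A' refl)
  have "distr (distr \<pi> borel T) borel fst = rotate_measure A \<mu>"
  proof -
    have "distr (distr \<pi> borel T) borel fst = distr \<pi> borel (fst \<circ> T)"
      by (rule distr_distr[OF fst_m T]) simp
    also have "fst \<circ> T = rotate_about A a \<circ> fst" by (auto simp: T_def)
    also have "distr \<pi> borel \<dots> = distr (distr \<pi> borel fst) borel (rotate_about A a)"
      by (rule distr_distr[OF rot fst_m[OF s], symmetric])
    finally show ?thesis by (simp add: d1 rotate_measure_def a_def)
  qed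
  moreover have "distr (distr \<pi> borel T) borel snd = rotate_measure A \<nu>"
  proof -
    have "distr (distr \<pi> borel T) borel snd = distr \<pi> borel (snd \<circ> T)"
      by (rule distr_distr[OF snd_m T]) simp
    also have "snd \<circ> T = rotate_about A b \<circ> snd" by (auto simp: T_def)
    also have "distr \<pi> borel \<dots> = distr (distr \<pi> borel snd) borel (rotate_about A b)"
      by (rule distr_distr[OF rot snd_m[OF s], symmetric])
    finally show ?thesis by (simp add: d2 rotate_measure_def b_def)
  qed
  ultimately have "distr \<pi> borel T \<in> couplings (rotate_measure A \<mu>) (rotate_measure A \<nu>)"
    by (simp add: couplings_def prob_space_distr[OF T])
  moreover have "(\<integral>p. (dist (fst p) (snd p))\<^sup>2 \<partial>distr \<pi> borel T) =
      (\<integral>p. (dist (fst p) (snd p))\<^sup>2 \<partial>\<pi>)"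
  proof -
    define u where "u p = (fst (fst p) - a) - (fst (snd p) - b)" for p :: "('h \<times> 'y) \<times> ('h \<times> 'y)"
    have mi: "(\<lambda>x::'h \<times> 'y. (fst x - c) \<bullet> w) \<in> borel_measurable borel" for c w
      by (intro borel_measurable_continuous_onI continuous_intros)
    have I0: "integrable \<rho> (\<lambda>x. (fst x - c) \<bullet> w)" if "\<rho> \<in> P2" for \<rho> c w
    proof -
      interpret R: prob_space \<rho> using P2D(1)[OF that] .
      show ?thesis using P2_integrable_inner_fst[OF that] by (simp add: inner_diff_left)
    qed
    have I1: "integrable \<pi> (\<lambda>p. (fst (fst p) - a) \<bullet> w)" for w
      using I0[OF \<mu>] integrable_distr_eq[OF fst_m[OF s] mi] d1 by simp
    have I2: "integrable \<pi> (\<lambda>p. (fst (snd p) - b) \<bullet> w)" for w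
      using I0[OF \<nu>] integrable_distr_eq[OF snd_m[OF s] mi] d2 by simp
    \<comment> \<open>The marginal conditions move these integrals to \<mu> and \<nu>, where the
      centred coordinate has mean zero.\<close>
    have E1: "(\<integral>p. (fst (fst p) - a) \<bullet> w \<partial>\<pi>) = 0" for w
      using integral_inner_fst_diff_barycenter[OF \<mu>] integral_distr[OF fst_m[OF s] mi, of a w] d1
      by (simp add: a_def)
    have E2: "(\<integral>p. (fst (snd p) - b) \<bullet> w \<partial>\<pi>) = 0" for w
      using integral_inner_fst_diff_barycenter[OF \<nu>] integral_distr[OF snd_m[OF s] mi, of b w] d2
      by (simp add: b_def)
    \<comment> \<open>The instantiation \<open>"_ - a"\<close> splits only the outer difference,
      keeping the centred terms of \<open>I1\<close> and \<open>I2\<close> intact.\<close>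
    have uI: "integrable \<pi> (\<lambda>p. u p \<bullet> w)" for w
      using I1 I2 unfolding u_def inner_diff_left[of "_ - a"] by simp
    have uE: "(\<integral>p. u p \<bullet> w \<partial>\<pi>) = 0" for w
      using I1 I2 E1 E2 unfolding u_def inner_diff_left[of "_ - a"] by simp
    \<comment> \<open>\<open>w\<close> stands for the preimage of a - b under \<open>A\<close>; it
      moves \<open>A\<close> off \<open>u p\<close> in the cross term.\<close>
    obtain w where w: "A w = a - b" using A'(2) by (metis surj_def)
    have cost: "(dist (fst (T p)) (snd (T p)))\<^sup>2 =
        (dist (fst p) (snd p))\<^sup>2 + 2 * (u p \<bullet> (w - (a - b)))" for p
    proof -
      have sq: "(norm (x + y))\<^sup>2 = x \<bullet> x + y \<bullet> y + 2 * (x \<bullet> y)" for x y :: 'h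
        by (simp add: power2_norm_eq_inner inner_add inner_commute)
      have e1: "fst (fst (T p)) - fst (snd (T p)) = A (u p) + (a - b)"
        by (simp add: T_def rotate_about_def u_def linear_diff[OF A'(3)])
      have e2: "fst (fst p) - fst (snd p) = u p + (a - b)"
        by (simp add: u_def)
      have e3: "A (u p) \<bullet> (a - b) = u p \<bullet> w" using A'(4)[of "u p" w] by (simp add: w)
      have e4: "snd (fst (T p)) = snd (fst p)" "snd (snd (T p)) = snd (snd p)"
        by (simp_all add: T_def rotate_about_def)
      have d: "(dist x y)\<^sup>2 = (norm (fst x - fst y))\<^sup>2 + (dist (snd x) (snd y))\<^sup>2"
        for x y :: "'h \<times> 'y"
        by (simp add: dist_prod_def dist_norm)
      show ?thesis
        unfolding d e4 e1 e2 sq e3 A'(4) inner_diff_right[of "u p" w] by simp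
    qed
    have "(\<lambda>p::('h \<times> 'y) \<times> ('h \<times> 'y). (dist (fst p) (snd p))\<^sup>2) \<in> borel_measurable borel"
      by (intro borel_measurable_continuous_onI continuous_intros)
    then have "(\<integral>p. (dist (fst p) (snd p))\<^sup>2 \<partial>distr \<pi> borel T) =
        (\<integral>p. (dist (fst (T p)) (snd (T p)))\<^sup>2 \<partial>\<pi>)"
      by (rule integral_distr[OF T])
    also have "\<dots> = (\<integral>p. (dist (fst p) (snd p))\<^sup>2 \<partial>\<pi>) +
        (\<integral>p. 2 * (u p \<bullet> (w - (a - b))) \<partial>\<pi>)"
      unfolding cost
      by (intro Bochner_Integration.integral_add integrable_cost[OF \<mu> \<nu> \<pi>]
          integrable_mult_right uI)
    also have "\<dots> = (\<integral>p. (dist (fst p) (snd p))\<^sup>2 \<partial>\<pi>)" by (simp add: uE)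
    finally show ?thesis .
  qed
  ultimately show ?thesis by blast
qed

lemma orthogonal_group_inverse:
  assumes "A \<in> carrier orthogonal_group"
  obtains B where "B \<in> carrier orthogonal_group" "A \<circ> B = id" "B \<circ> A = id"
proof -
  interpret group orthogonal_group by (rule group_orthogonal_group)
  show thesis
    using that[of "inv\<^bsub>orthogonal_group\<^esub> A"] assms r_inv[of A] l_inv[of A] inv_closed[of A]
    by (simp add: orthogonal_group_def)
qed

text \<open>The sets of attainable costs coincide: the coupling lemma gives one inclusion, and
  applied to the inverse of \<open>A\<close> it gives the other. The infima then agree whether or
  not they are attained.\<close>

lemma W2_rotate_measure:
  fixes \<mu> \<nu> :: "('h::{real_inner, complete_space} \<times> 'y::metric_space) measure"
  assumes A: "A \<in> carrier orthogonal_group" and \<mu>: "\<mu> \<in> P2" and \<nu>: "\<nu> \<in> P2"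
  shows "W2 (rotate_measure A \<mu>) (rotate_measure A \<nu>) = W2 \<mu> \<nu>"
proof -
  define c where "c \<pi> = sqrt (\<integral>p. (dist (fst p) (snd p))\<^sup>2 \<partial>\<pi>)"
    for \<pi> :: "(('h \<times> 'y) \<times> ('h \<times> 'y)) measure"
  \<comment> \<open>Stated for arbitrary data so that it can also be used for \<open>B\<close> and
    the rotated measures.\<close>
  have sub: "c ` couplings \<mu> \<nu> \<subseteq> c ` couplings (rotate_measure A \<mu>) (rotate_measure A \<nu>)"
    if *: "A \<in> carrier orthogonal_group" "\<mu> \<in> P2" "\<nu> \<in> P2" for A and \<mu> \<nu> :: "('h \<times> 'y) measure"
  proof
    fix r assume "r \<in> c ` couplings \<mu> \<nu>"
    then obtain \<pi> where \<pi>: "\<pi> \<in> couplings \<mu> \<nu>" "r = c \<pi>" by blast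
    obtain \<pi>' where "\<pi>' \<in> couplings (rotate_measure A \<mu>) (rotate_measure A \<nu>)" "c \<pi>' = c \<pi>"
      unfolding c_def using rotate_measure_coupling[OF * \<pi>(1)] by auto
    then show "r \<in> c ` couplings (rotate_measure A \<mu>) (rotate_measure A \<nu>)"
      using \<pi>(2) by (metis imageI)
  qed
  obtain B where B: "B \<in> carrier orthogonal_group" "B \<circ> A = id"
    using orthogonal_group_inverse[OF A] by metis
  note P = rotate_measure_P2[OF orthogonal_groupD(1)[OF A]]
  have "rotate_measure B (rotate_measure A \<rho>) = \<rho>" if "\<rho> \<in> P2" for \<rho> :: "('h \<times> 'y) measure"
    using rotate_measure_comp[OF B(1) A that] rotate_measure_id[OF that] B(2) by simp
  then have "c ` couplings \<mu> \<nu> = c ` couplings (rotate_measure A \<mu>) (rotate_measure A \<nu>)"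
    using sub[OF A \<mu> \<nu>] sub[OF B(1) P[OF \<mu>] P[OF \<nu>]] \<mu> \<nu> by auto
  then show ?thesis by (simp add: W2_def c_def[symmetric])
qed

lemma bij_betw_rotate_measure:
  fixes A :: "'h::{real_inner, complete_space} \<Rightarrow> 'h"
  assumes A: "A \<in> carrier orthogonal_group"
  shows "bij_betw (rotate_measure A) P2 (P2 :: ('h \<times> 'y::metric_space) measure set)"
proof -
  obtain B where B: "B \<in> carrier orthogonal_group" "A \<circ> B = id" "B \<circ> A = id"
    using orthogonal_group_inverse[OF A] by metis
  show ?thesis
  proof (rule bij_betw_byWitness[where f' = "rotate_measure B"])
    show "\<forall>\<mu>\<in>P2. rotate_measure B (rotate_measure A \<mu>) = \<mu>"
      by (simp add: rotate_measure_comp[OF B(1) A, symmetric] B rotate_measure_id)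
    show "\<forall>\<mu>\<in>P2. rotate_measure A (rotate_measure B \<mu>) = \<mu>"
      by (simp add: rotate_measure_comp[OF A B(1), symmetric] B rotate_measure_id)
  qed (use rotate_measure_P2 orthogonal_groupD(1) A B(1) in blast)+
qed

text \<open>\<open>restrict\<close> is there because the elements of \<open>Bij\<close> are
  extensional, that is, \<open>undefined\<close> outside \<open>P2\<close>.\<close>

lemma group_action_rotate_measure:
  "group_action orthogonal_group (P2 :: ('h::{real_inner, complete_space} \<times> 'y::metric_space) measure set)
     (\<lambda>A. restrict (rotate_measure A) P2)"
proof (intro group_action.intro group_hom.intro group_orthogonal_group group_BijGroup
    group_hom_axioms.intro)
  let ?R = "\<lambda>A. restrict (rotate_measure A) (P2 :: ('h \<times> 'y) measure set)"
  have Bij: "?R A \<in> Bij P2" if "A \<in> carrier orthogonal_group" for A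
    using bij_betw_rotate_measure[OF that] by (simp add: Bij_def bij_betw_restrict_eq)
  show "?R \<in> hom orthogonal_group (BijGroup P2)"
  proof (rule homI)
    fix A B :: "'h \<Rightarrow> 'h"
    assume A: "A \<in> carrier orthogonal_group" and B: "B \<in> carrier orthogonal_group"
    show "?R A \<in> carrier (BijGroup P2)" using Bij[OF A] by (simp add: BijGroup_def)
    have "?R (A \<circ> B) = compose P2 (?R A) (?R B)"
      using rotate_measure_P2[OF orthogonal_groupD(1)[OF B]] rotate_measure_comp[OF A B]
      by (auto simp: compose_def fun_eq_iff restrict_def)
    then show "?R (A \<otimes>\<^bsub>orthogonal_group\<^esub> B) = ?R A \<otimes>\<^bsub>BijGroup P2\<^esub> ?R B"
      using Bij[OF A] Bij[OF B] by (simp add: BijGroup_def) (simp add: orthogonal_group_def)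
  qed
qed

section \<open>Dirac measures and exoticness\<close>

lemma return_P2: "return borel x \<in> P2"
proof -
  have "(\<lambda>z. (dist z x)\<^sup>2) \<in> borel_measurable borel"
    by (intro borel_measurable_continuous_onI continuous_intros)
  then have "integrable (return borel x) (\<lambda>z. (dist z x)\<^sup>2)"
    by (intro integrableI_bounded) (simp_all add: nn_integral_return)
  then show ?thesis by (auto simp: P2_def intro!: prob_space_return)
qed

lemma return_borel_inject:
  fixes x y :: "'a::metric_space"
  assumes "return borel x = return borel y"
  shows "x = y"
proof -
  have "emeasure (return borel x) {x} = emeasure (return borel y) {x}" using assms by simp
  then show ?thesis by (simp add: indicator_def split: if_splits)
qed

text \<open>The barycenter of a Dirac measure is the \<open>H\<close>-coordinate of its point, so
  the point lies over the centre of rotation. This forces any inducing isometry to fix all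
  points.\<close>

lemma rotate_measure_return:
  fixes x :: "'h::real_inner \<times> 'y::metric_space"
  assumes "orthogonal_transformation A"
  shows "rotate_measure A (return borel x) = return borel x"
proof -
  have m: "(\<lambda>x::'h \<times> 'y. fst x \<bullet> v) \<in> borel_measurable borel" for v
    by (intro borel_measurable_continuous_onI continuous_intros)
  have "barycenter (return borel x) = fst x"
    by (rule barycenter_eqI) (simp add: integral_return m)
  moreover have "rotate_about A (fst x) x = x"
    using assms by (simp add: rotate_about_def orthogonal_transformation_def linear_0)
  ultimately show ?thesis
    by (simp add: rotate_measure_def distr_return rotate_about_measurable[OF assms])
qed

text \<open>The unequal weights of the test measure matter: the measure with equal masses at \<open>h\<close> and \<open>-h\<close>
  is fixed whenever \<open>A h = -h\<close>.\<close>

lemma rotate_measure_neq: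
  fixes A :: "'h::{real_inner, complete_space} \<Rightarrow> 'h"
  assumes A: "A \<in> carrier orthogonal_group" and "A \<noteq> id"
  obtains \<mu> :: "('h \<times> 'y::metric_space) measure" where "\<mu> \<in> P2" "rotate_measure A \<mu> \<noteq> \<mu>"
proof -
  obtain h where h: "A h \<noteq> h" using \<open>A \<noteq> id\<close> by (metis eq_id_iff)
  fix y :: 'y
  define f where "f t = (if t then (2 *\<^sub>R h, y) else (- h, y))" for t
  define \<mu> where "\<mu> = distr (measure_pmf (bernoulli_pmf (1/3))) borel f"
  have f: "f \<in> measurable (measure_pmf (bernoulli_pmf (1/3))) borel" by simp
  have "(\<lambda>x::'h \<times> 'y. (dist x (0, y))\<^sup>2) \<in> borel_measurable borel"
    by (intro borel_measurable_continuous_onI continuous_intros)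
  then have "integrable \<mu> (\<lambda>x. (dist x (0, y))\<^sup>2)"
    unfolding \<mu>_def by (subst integrable_distr_eq[OF f]) (auto intro: integrable_measure_pmf_finite)
  then have P: "\<mu> \<in> P2"
    using measure_pmf.prob_space_distr[OF f] by (auto simp: P2_def \<mu>_def)
  have m: "(\<lambda>x::'h \<times> 'y. fst x \<bullet> v) \<in> borel_measurable borel" for v
    by (intro borel_measurable_continuous_onI continuous_intros)
  \<comment> \<open>The weights balance: 1/3 of 2h plus 2/3 of -h is 0, so the rotation applies
    \<open>A\<close> itself to the first coordinate.\<close>
  have b: "barycenter \<mu> = 0"
    by (rule barycenter_eqI) (simp add: \<mu>_def integral_distr[OF f m] f_def)
  note r = rotate_about_measurable[OF orthogonal_groupD(1)[OF A] refl, of 0]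
  have g: "rotate_measure A \<mu> = distr (measure_pmf (bernoulli_pmf (1/3))) borel
      (\<lambda>t. rotate_about A 0 (f t))"
    unfolding rotate_measure_def b unfolding \<mu>_def
    by (subst distr_distr[OF r f]) (simp add: comp_def)
  have l: "A (- h) = - A h" "A (2 *\<^sub>R h) = 2 *\<^sub>R A h"
    using orthogonal_groupD(3)[OF A] by (simp_all add: linear_neg linear_scale)
  have mass: "measure \<mu> {(- h, y)} \<ge> 2/3"
  proof -
    have "measure (measure_pmf (bernoulli_pmf (1/3))) {False} \<le> measure \<mu> {(- h, y)}"
      unfolding \<mu>_def by (subst measure_distr[OF f]) (auto simp: f_def intro!: measure_pmf.finite_measure_mono)
    then show ?thesis by (simp add: measure_pmf_single)
  qed
  \<comment> \<open>The atom of weight 2/3 has moved to -A h, which differs from -h. At most the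
    other atom, of weight 1/3, can lie at the old place.\<close>
  have "measure (rotate_measure A \<mu>) {(- h, y)} \<le> measure (measure_pmf (bernoulli_pmf (1/3))) {True}"
    unfolding g by (subst measure_distr)
      (use h in \<open>auto simp: f_def rotate_about_def l split: if_splits intro!: measure_pmf.finite_measure_mono\<close>)
  also have "\<dots> = 1/3" by (simp add: measure_pmf_single)
  finally have "rotate_measure A \<mu> \<noteq> \<mu>" using mass by auto
  then show thesis using that P by blast
qed

theorem theorem1:
  assumes dim_ge_1: "(UNIV :: 'h::{real_inner, polish_space} set) \<noteq> {0}"
    and proper: "\<forall>S :: 'y::metric_space set. closed S \<and> bounded S \<longrightarrow> compact S"
  shows "\<exists>\<Phi> :: ('h \<Rightarrow> 'h) \<Rightarrow> ('h \<times> 'y) measure \<Rightarrow> ('h \<times> 'y) measure.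
           group_action orthogonal_group P2 \<Phi> \<and>
           (\<forall>A \<in> carrier orthogonal_group. \<Phi> A \<in> isometries P2 W2) \<and>
           (\<forall>A \<in> carrier orthogonal_group. A \<noteq> \<one>\<^bsub>orthogonal_group\<^esub> \<longrightarrow> exotic (\<Phi> A))"
proof -
  let ?R = "\<lambda>A :: 'h \<Rightarrow> 'h. restrict (rotate_measure A) (P2 :: ('h \<times> 'y) measure set)"
  have iso: "?R A \<in> isometries P2 W2" if "A \<in> carrier orthogonal_group" for A
    using bij_betw_rotate_measure[OF that, where 'y = 'y] W2_rotate_measure[OF that, where 'y = 'y]
    by (auto simp: isometries_def bij_betw_def)
  have "exotic (?R A)"
    if A: "A \<in> carrier orthogonal_group" and ne: "A \<noteq> \<one>\<^bsub>orthogonal_group\<^esub>" for A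
    unfolding exotic_def
  proof (intro conjI notI iso A)
    assume "\<exists>\<phi>\<in>isometries UNIV dist. \<forall>\<mu>\<in>P2. ?R A \<mu> = distr \<mu> borel \<phi>"
    then obtain \<phi> :: "'h \<times> 'y \<Rightarrow> 'h \<times> 'y" where \<phi>: "\<phi> \<in> isometries UNIV dist"
      and eq: "\<And>\<mu>. \<mu> \<in> P2 \<Longrightarrow> rotate_measure A \<mu> = distr \<mu> borel \<phi>" by auto
    have "continuous_on UNIV \<phi>"
      using \<phi> by (auto simp: continuous_on_iff isometries_def)
    then have "\<phi> \<in> measurable borel borel" by (rule borel_measurable_continuous_onI)
    \<comment> \<open>The push-forward of the Dirac measure at \<open>x\<close> is the one at
      \<open>\<phi> x\<close>, so Dirac measures read off the values of \<phi>.\<close>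
    then have "return borel (\<phi> x) = return borel x" for x
      using eq[OF return_P2, of x] rotate_measure_return[OF orthogonal_groupD(1)[OF A], of x]
      by (simp add: distr_return)
    then have "\<phi> = (\<lambda>x. x)" using return_borel_inject by blast
    then have "rotate_measure A \<mu> = \<mu>" if "\<mu> \<in> P2" for \<mu> :: "('h \<times> 'y) measure"
      using eq[OF that] P2D(2)[OF that] by (simp add: distr_id2)
    moreover have "A \<noteq> id" using ne by (simp add: orthogonal_group_def)
    ultimately show False using rotate_measure_neq[OF A, where 'y = 'y] by metis
  qed
  then show ?thesis using iso group_action_rotate_measure by blast
qed

end
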